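(* For every integer $n\ge 1$ and each $m\in\{1,2,3\}$, $\chi_{la}(H_m(n))=3$.
   Context: For a graph $G=(V,E)$ with $|E|=m$ and no isolated vertices, a local antimagic labeling is a bijection $f:E\to\{1,\dots,m\}$ such that $f^+(u)\ne f^+(v)$ for every edge $uv$, where $f^+(x)=\sum f(e)$ over all edges $e$ incident to $x$. The local antimagic chromatic number $\chi_{la}(G)$ is the minimum, over all local antimagic labelings $f$ of $G$, of the number of distinct values taken by $f^+$ (also for disconnected graphs). Merging a set of vertices means identifying them into one vertex incident to all edges previously incident to any of them. Take $n$ disjoint copies of $C_4(8,2)$ indexed $i=1,\dots,n$, the $i$-th copy having vertices $\{u_{i,t},v_{i,t}:1\le t\le 8\}$ and edges $u_{i,t}u_{i,t+1}$, $v_{i,t}v_{i,t+1}$ ($1\le t\le 8$, second index mod 8) and $u_{i,2j}v_{i,2j}$ ($1\le j\le 4$). For each $i\in[1,n]$: $H_1(n)$ is obtained by merging $\{u_{i,1},u_{i,5}\}$, $\{u_{i,3},u_{i,7}\}$, $\{v_{i,1},v_{i,5}\}$, $\{v_{i,3},v_{i,7}\}$ (each pair into one degree-4 vertex); $H_2(n)$ is obtained by merging $\{u_{i,1},v_{i,7}\}$, $\{u_{i,5},v_{i,3}\}$, $\{u_{i,3},v_{i,5}\}$, $\{u_{i,7},v_{i,1}\}$; $H_3(n)$ is obtained by merging $\{u_{i,1},v_{i,1}\}$, $\{u_{i,5},v_{i,5}\}$, $\{u_{i,3},v_{i,3}\}$, $\{u_{i,7},v_{i,7}\}$. *)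

theory Defs
  imports Main
begin

type_synonym 'a ugraph = "'a set \<times> 'a set set"

abbreviation verts :: "'a ugraph \<Rightarrow> 'a set" where "verts G \<equiv> fst G"
abbreviation edges :: "'a ugraph \<Rightarrow> 'a set set" where "edges G \<equiv> snd G"

definition simple_graph :: "'a ugraph \<Rightarrow> bool" where
  "simple_graph G \<longleftrightarrow> finite (verts G) \<and> (\<forall>e\<in>edges G. e \<subseteq> verts G \<and> card e = 2)"

definition no_isolated :: "'a ugraph \<Rightarrow> bool" where
  "no_isolated G \<longleftrightarrow> (\<forall>x\<in>verts G. \<exists>e\<in>edges G. x \<in> e)"

definition vsum :: "'a ugraph \<Rightarrow> ('a set \<Rightarrow> nat) \<Rightarrow> 'a \<Rightarrow> nat" where
  "vsum G f x = (\<Sum>e\<in>{e\<in>edges G. x \<in> e}. f e)"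

definition local_antimagic :: "'a ugraph \<Rightarrow> ('a set \<Rightarrow> nat) \<Rightarrow> bool" where
  "local_antimagic G f \<longleftrightarrow>
     bij_betw f (edges G) {1..card (edges G)} \<and>
     (\<forall>u v. {u, v} \<in> edges G \<longrightarrow> vsum G f u \<noteq> vsum G f v)"

(* On nat, Inf {} = 0, so the value is positive for a graph with a vertex only if some
   local antimagic labeling exists, and then Inf is the minimum. *)
definition chi_la :: "'a ugraph \<Rightarrow> nat" where
  "chi_la G = Inf {card (vsum G f ` verts G) | f. local_antimagic G f}"

(* Merging the blocks of a family M of pairwise disjoint vertex sets: the vertices of the
   result are the blocks themselves, and {x} for every vertex x in no block. The edges are
   the images of the old ones; that none of them becomes a loop
   and no two become parallel for the graphs considered here is shown in simple_graph_merge
   and inj_on_edges, so the set of edges of the merged graph loses no edge. *)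
definition block :: "'a set set \<Rightarrow> 'a \<Rightarrow> 'a set" where
  "block M x = {x} \<union> \<Union>{B\<in>M. x \<in> B}"

definition merge :: "'a set set \<Rightarrow> 'a ugraph \<Rightarrow> 'a set ugraph" where
  "merge M G = (block M ` verts G, (\<lambda>e. block M ` e) ` edges G)"

datatype vertex = U nat nat | V nat nat

definition nxt :: "nat \<Rightarrow> nat" where
  "nxt t = t mod 8 + 1"

(* n disjoint copies of C_4(8,2) *)
definition copies :: "nat \<Rightarrow> vertex ugraph" where
  "copies n =
     ({U i t | i t. i \<in> {1..n} \<and> t \<in> {1..8}} \<union> {V i t | i t. i \<in> {1..n} \<and> t \<in> {1..8}},
      {{U i t, U i (nxt t)} | i t. i \<in> {1..n} \<and> t \<in> {1..8}} \<union>
      {{V i t, V i (nxt t)} | i t. i \<in> {1..n} \<and> t \<in> {1..8}} \<union>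
      {{U i (2*j), V i (2*j)} | i j. i \<in> {1..n} \<and> j \<in> {1..4}})"

definition M1 :: "nat \<Rightarrow> vertex set set" where
  "M1 n = (\<Union>i\<in>{1..n}. {{U i 1, U i 5}, {U i 3, U i 7}, {V i 1, V i 5}, {V i 3, V i 7}})"

definition M2 :: "nat \<Rightarrow> vertex set set" where
  "M2 n = (\<Union>i\<in>{1..n}. {{U i 1, V i 7}, {U i 5, V i 3}, {U i 3, V i 5}, {U i 7, V i 1}})"

definition M3 :: "nat \<Rightarrow> vertex set set" where
  "M3 n = (\<Union>i\<in>{1..n}. {{U i 1, V i 1}, {U i 5, V i 5}, {U i 3, V i 3}, {U i 7, V i 7}})"

definition H1 :: "nat \<Rightarrow> vertex set ugraph" where "H1 n = merge (M1 n) (copies n)"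
definition H2 :: "nat \<Rightarrow> vertex set ugraph" where "H2 n = merge (M2 n) (copies n)"
definition H3 :: "nat \<Rightarrow> vertex set ugraph" where "H3 n = merge (M3 n) (copies n)"


lemma block_UN:
  assumes "i \<in> I" "\<And>j B. j \<in> I \<Longrightarrow> B \<in> F j \<Longrightarrow> x \<in> B \<Longrightarrow> j = i"
  shows "block (\<Union>j\<in>I. F j) x = {x} \<union> \<Union>{B\<in>F i. x \<in> B}"
  unfolding block_def using assms by blast

lemma Union_filter_insert:
  "\<Union>{B\<in>insert A F. x \<in> B} = (if x \<in> A then A else {}) \<union> \<Union>{B\<in>F. x \<in> B}"
  by auto

lemma Union_filter_empty: "\<Union>{B\<in>{}. x \<in> B} = {}"
  by simp

lemma block_M1:
  assumes "i \<in> {1..n}"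
  shows "block (M1 n) (U i 1) = {U i 1, U i 5}" "block (M1 n) (U i 2) = {U i 2}"
    "block (M1 n) (U i 3) = {U i 3, U i 7}" "block (M1 n) (U i 4) = {U i 4}"
    "block (M1 n) (U i 5) = {U i 1, U i 5}" "block (M1 n) (U i 6) = {U i 6}"
    "block (M1 n) (U i 7) = {U i 3, U i 7}" "block (M1 n) (U i 8) = {U i 8}"
    "block (M1 n) (V i 1) = {V i 1, V i 5}" "block (M1 n) (V i 2) = {V i 2}"
    "block (M1 n) (V i 3) = {V i 3, V i 7}" "block (M1 n) (V i 4) = {V i 4}"
    "block (M1 n) (V i 5) = {V i 1, V i 5}" "block (M1 n) (V i 6) = {V i 6}"
    "block (M1 n) (V i 7) = {V i 3, V i 7}" "block (M1 n) (V i 8) = {V i 8}"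
  unfolding M1_def
  by ((subst block_UN[OF assms], fastforce,
       simp only: Union_filter_insert Union_filter_empty, simp add: insert_commute)+)

lemma block_M2:
  assumes "i \<in> {1..n}"
  shows "block (M2 n) (U i 1) = {U i 1, V i 7}" "block (M2 n) (U i 2) = {U i 2}"
    "block (M2 n) (U i 3) = {U i 3, V i 5}" "block (M2 n) (U i 4) = {U i 4}"
    "block (M2 n) (U i 5) = {U i 5, V i 3}" "block (M2 n) (U i 6) = {U i 6}"
    "block (M2 n) (U i 7) = {U i 7, V i 1}" "block (M2 n) (U i 8) = {U i 8}"
    "block (M2 n) (V i 1) = {U i 7, V i 1}" "block (M2 n) (V i 2) = {V i 2}"
    "block (M2 n) (V i 3) = {U i 5, V i 3}" "block (M2 n) (V i 4) = {V i 4}"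
    "block (M2 n) (V i 5) = {U i 3, V i 5}" "block (M2 n) (V i 6) = {V i 6}"
    "block (M2 n) (V i 7) = {U i 1, V i 7}" "block (M2 n) (V i 8) = {V i 8}"
  unfolding M2_def
  by ((subst block_UN[OF assms], fastforce,
       simp only: Union_filter_insert Union_filter_empty, simp add: insert_commute)+)

lemma block_M3:
  assumes "i \<in> {1..n}"
  shows "block (M3 n) (U i 1) = {U i 1, V i 1}" "block (M3 n) (U i 2) = {U i 2}"
    "block (M3 n) (U i 3) = {U i 3, V i 3}" "block (M3 n) (U i 4) = {U i 4}"
    "block (M3 n) (U i 5) = {U i 5, V i 5}" "block (M3 n) (U i 6) = {U i 6}"
    "block (M3 n) (U i 7) = {U i 7, V i 7}" "block (M3 n) (U i 8) = {U i 8}"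
    "block (M3 n) (V i 1) = {U i 1, V i 1}" "block (M3 n) (V i 2) = {V i 2}"
    "block (M3 n) (V i 3) = {U i 3, V i 3}" "block (M3 n) (V i 4) = {V i 4}"
    "block (M3 n) (V i 5) = {U i 5, V i 5}" "block (M3 n) (V i 6) = {V i 6}"
    "block (M3 n) (V i 7) = {U i 7, V i 7}" "block (M3 n) (V i 8) = {V i 8}"
  unfolding M3_def
  by ((subst block_UN[OF assms], fastforce,
       simp only: Union_filter_insert Union_filter_empty, simp add: insert_commute)+)

definition E0 :: "nat \<Rightarrow> vertex set set" where
  "E0 i = {{U i 1, U i 2}, {U i 2, U i 3}, {U i 3, U i 4}, {U i 4, U i 5},
           {U i 5, U i 6}, {U i 6, U i 7}, {U i 7, U i 8}, {U i 8, U i 1},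
           {V i 1, V i 2}, {V i 2, V i 3}, {V i 3, V i 4}, {V i 4, V i 5},
           {V i 5, V i 6}, {V i 6, V i 7}, {V i 7, V i 8}, {V i 8, V i 1},
           {U i 2, V i 2}, {U i 4, V i 4}, {U i 6, V i 6}, {U i 8, V i 8}}"

definition V0 :: "nat \<Rightarrow> vertex set" where
  "V0 i = {U i 1, U i 2, U i 3, U i 4, U i 5, U i 6, U i 7, U i 8,
           V i 1, V i 2, V i 3, V i 4, V i 5, V i 6, V i 7, V i 8}"

lemma atLeastAtMost_1_8: "{1..8::nat} = {1,2,3,4,5,6,7,8}"
  by auto

lemma atLeastAtMost_1_4: "{1..4::nat} = {1,2,3,4}"
  by auto

lemma nxt_simps:
  "nxt 1 = 2" "nxt 2 = 3" "nxt 3 = 4" "nxt 4 = 5" "nxt 5 = 6" "nxt 6 = 7" "nxt 7 = 8" "nxt 8 = 1"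
  by (simp_all add: nxt_def)

lemma dbl_simps: "2 * 1 = (2::nat)" "2 * 2 = (4::nat)" "2 * 3 = (6::nat)" "2 * 4 = (8::nat)"
  by simp_all

lemma verts_copies: "verts (copies n) = (\<Union>i\<in>{1..n}. V0 i)"
  unfolding copies_def V0_def atLeastAtMost_1_8 by auto

lemma edges_copies: "edges (copies n) = (\<Union>i\<in>{1..n}. E0 i)"
proof -
  have "edges (copies n) =
     (\<Union>i\<in>{1..n}. (\<lambda>t. {U i t, U i (nxt t)}) ` {1..8} \<union> (\<lambda>t. {V i t, V i (nxt t)}) ` {1..8} \<union>
        (\<lambda>j. {U i (2*j), V i (2*j)}) ` {1..4})"
  proof -
    have "{{U i t, U i (nxt t)} | i t. i \<in> {1..n} \<and> t \<in> {1..8}} =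
        (\<Union>i\<in>{1..n}. (\<lambda>t. {U i t, U i (nxt t)}) ` {1..8})"
      "{{V i t, V i (nxt t)} | i t. i \<in> {1..n} \<and> t \<in> {1..8}} =
        (\<Union>i\<in>{1..n}. (\<lambda>t. {V i t, V i (nxt t)}) ` {1..8})"
      "{{U i (2*j), V i (2*j)} | i j. i \<in> {1..n} \<and> j \<in> {1..4}} =
        (\<Union>i\<in>{1..n}. (\<lambda>j. {U i (2*j), V i (2*j)}) ` {1..4})"
      by blast+
    then show ?thesis
      unfolding copies_def snd_conv by (simp only: UN_Un_distrib)
  qed
  also have "\<dots> = (\<Union>i\<in>{1..n}. E0 i)"
  proof (rule SUP_cong[OF refl])
    fix i
    show "(\<lambda>t. {U i t, U i (nxt t)}) ` {1..8} \<union> (\<lambda>t. {V i t, V i (nxt t)}) ` {1..8} \<union>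
        (\<lambda>j. {U i (2*j), V i (2*j)}) ` {1..4} = E0 i"
      unfolding atLeastAtMost_1_8 atLeastAtMost_1_4 E0_def
      by (simp only: image_insert image_empty Un_insert_left Un_empty_left nxt_simps dbl_simps)
  qed
  finally show ?thesis .
qed

lemma inj_on_edges_UN:
  fixes q :: "vertex \<Rightarrow> vertex set"
  assumes inj: "\<And>i. i \<in> {1..n} \<Longrightarrow> inj_on (\<lambda>e. q ` e) (E0 i)"
    and idx: "\<And>i x. i \<in> {1..n} \<Longrightarrow> x \<in> V0 i \<Longrightarrow> x \<in> q x \<and> q x \<subseteq> V0 i"
  shows "inj_on (\<lambda>e. q ` e) (\<Union>i\<in>{1..n}. E0 i)"
proof (rule inj_onI)
  fix e e' assume e: "e \<in> (\<Union>i\<in>{1..n}. E0 i)" and e': "e' \<in> (\<Union>i\<in>{1..n}. E0 i)" and eq: "q ` e = q ` e'"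
  from e obtain i where i: "i \<in> {1..n}" "e \<in> E0 i" by auto
  from e' obtain j where j: "j \<in> {1..n}" "e' \<in> E0 j" by auto
  have sub: "e \<subseteq> V0 k \<and> e \<noteq> {}" if "e \<in> E0 k" for e k
    using that unfolding E0_def V0_def by (elim insertE emptyE) simp_all
  obtain x where x: "x \<in> e" "x \<in> V0 i" using sub[OF i(2)] by auto
  have "q x \<in> q ` e'" using x(1) eq by blast
  then obtain y where y: "y \<in> e'" "q x = q y" by blast
  then have "y \<in> V0 j" using sub[OF j(2)] by auto
  then have "q x \<subseteq> V0 j" using idx[OF j(1)] y(2) by simp
  moreover have "x \<in> q x" using idx[OF i(1) x(2)] by simp
  ultimately have "x \<in> V0 j" by (rule subsetD)
  then have "i = j" using x(2) unfolding V0_def by auto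
  then have "e' \<in> E0 i" using j(2) by simp
  from inj_onD[OF inj[OF i(1)] eq i(2) this] show "e = e'" .
qed

lemma inj_on_edges:
  assumes "M \<in> {M1 n, M2 n, M3 n}"
  shows "inj_on (\<lambda>e. block M ` e) (edges (copies n))"
proof -
  have 1: "inj_on (\<lambda>e. block (M1 n) ` e) (E0 i)" if "i \<in> {1..n}" for i
    unfolding E0_def by (simp add: block_M1[OF that, simplified] doubleton_eq_iff)
  have 2: "inj_on (\<lambda>e. block (M2 n) ` e) (E0 i)" if "i \<in> {1..n}" for i
    unfolding E0_def by (simp add: block_M2[OF that, simplified] doubleton_eq_iff)
  have 3: "inj_on (\<lambda>e. block (M3 n) ` e) (E0 i)" if "i \<in> {1..n}" for i
    unfolding E0_def by (simp add: block_M3[OF that, simplified] doubleton_eq_iff)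
  have "x \<in> block M x \<and> block M x \<subseteq> V0 i" if "i \<in> {1..n}" "x \<in> V0 i" for i x
    using assms that(2) unfolding V0_def
    by (elim insertE emptyE)
       (simp_all add: block_M1[OF that(1), simplified] block_M2[OF that(1), simplified]
          block_M3[OF that(1), simplified])
  moreover have "inj_on (\<lambda>e. block M ` e) (E0 i)" if "i \<in> {1..n}" for i
    using assms 1[OF that] 2[OF that] 3[OF that] by (elim insertE emptyE) simp_all
  ultimately show ?thesis
    unfolding edges_copies by (intro inj_on_edges_UN)
qed

lemma simple_graph_merge:
  assumes "M \<in> {M1 n, M2 n, M3 n}"
  shows "simple_graph (merge M (copies n))" "no_isolated (merge M (copies n))"
proof -
  have c: "card (block M ` e) = 2 \<and> e \<subseteq> V0 i" if "i \<in> {1..n}" "e \<in> E0 i" for i e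
    using assms that(2) unfolding E0_def V0_def
    by (elim insertE emptyE)
       (simp_all add: block_M1[OF that(1), simplified] block_M2[OF that(1), simplified]
          block_M3[OF that(1), simplified] doubleton_eq_iff)
  have "finite (V0 i)" for i unfolding V0_def by simp
  then have fin: "finite (block M ` (\<Union>i\<in>{1..n}. V0 i))" by blast
  show "simple_graph (merge M (copies n))"
    unfolding simple_graph_def merge_def verts_copies edges_copies fst_conv snd_conv
  proof (intro conjI ballI fin)
    fix d assume "d \<in> (`) (block M) ` (\<Union>i\<in>{1..n}. E0 i)"
    then obtain i e where ie: "i \<in> {1..n}" "e \<in> E0 i" "d = block M ` e" by blast
    show "card d = 2" using c[OF ie(1,2)] ie(3) by simp
    have "e \<subseteq> (\<Union>i\<in>{1..n}. V0 i)" using c[OF ie(1,2)] ie(1) by blast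
    then show "d \<subseteq> block M ` (\<Union>i\<in>{1..n}. V0 i)" unfolding ie(3) by (rule image_mono)
  qed
  have ex: "\<exists>e\<in>E0 i. x \<in> e" if "x \<in> V0 i" for i x
    using that unfolding V0_def E0_def by (elim insertE emptyE) simp_all
  show "no_isolated (merge M (copies n))"
    unfolding no_isolated_def merge_def verts_copies edges_copies fst_conv snd_conv
  proof
    fix y assume "y \<in> block M ` (\<Union>i\<in>{1..n}. V0 i)"
    then obtain i x where ix: "i \<in> {1..n}" "x \<in> V0 i" "y = block M x" by blast
    from ex[OF ix(2)] obtain e where e: "e \<in> E0 i" "x \<in> e" by blast
    show "\<exists>e\<in>(`) (block M) ` (\<Union>i\<in>{1..n}. E0 i). y \<in> e"
    proof
      show "y \<in> block M ` e" using e(2) ix(3) by simp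
      show "block M ` e \<in> (`) (block M) ` (\<Union>i\<in>{1..n}. E0 i)" using e(1) ix(1) by blast
    qed
  qed
qed

end

theory Submission
  imports Defs
begin

text \<open>
  Label the copies so that every degree-2 vertex has the same sum \<open>s = 24n + 1\<close>. Then every merged
  vertex has sum \<open>2s\<close>, whichever degree-2 vertices are paired, so a single labelling serves all
  three graphs; the degree-3 vertices get the sums \<open>23n + 1\<close> and \<open>29n + 2\<close>, different at the two
  ends of each edge \<open>u\<^sub>2\<^sub>jv\<^sub>2\<^sub>j\<close>.
  For the lower bound, two colours are impossible in \<open>H\<^sub>2\<close> and \<open>H\<^sub>3\<close> because of a triangle. Each
  component of \<open>H\<^sub>1\<close> is bipartite with six vertices in each part; if only two sums \<open>p \<noteq> q\<close> occurred,
  summing over the parts would give \<open>6p = 6q\<close>, both being the sum of all labels of the component.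
\<close>

section \<open>Vertex sums in merged graphs\<close>

text \<open>Disjointness leaves at most one member of \<open>M\<close> through a given vertex, so
  \<open>block M x\<close> is that member or \<open>{x}\<close>, and the blocks are the classes of
  an equivalence relation.\<close>

lemma block_eq_iff:
  assumes "pairwise disjnt M"
  shows "block M y = block M x \<longleftrightarrow> y \<in> block M x"
proof
  show "y \<in> block M x" if "block M y = block M x"
    using that unfolding block_def by blast
next
  have block_member: "block M z = B" if "B \<in> M" "z \<in> B" for z B
    using assms that unfolding block_def pairwise_def disjnt_def by blast
  assume "y \<in> block M x"
  then consider "y = x" | B where "B \<in> M" "x \<in> B" "y \<in> B"
    unfolding block_def by blast
  then show "block M y = block M x"
    by cases (simp_all add: block_member)
qed

text \<open>The edges at a merged vertex are those at the members of its block: \<open>inj\<close>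
  keeps distinct edges distinct, and \<open>no_loops\<close> keeps an edge from being counted at two
  members.\<close>

lemma vsum_merge:
  assumes "pairwise disjnt M" "finite (edges G)" "finite (block M x)"
    and inj: "inj_on ((`) (block M)) (edges G)"
    and no_loops: "\<And>e. e \<in> edges G \<Longrightarrow> inj_on (block M) e"
  shows "vsum (merge M G) f (block M x) =
    (\<Sum>y\<in>block M x. vsum G (\<lambda>e. f (block M ` e)) y)"
proof -
  let ?I = "\<lambda>y. {e \<in> edges G. y \<in> e}"
  have "block M x \<in> block M ` e \<longleftrightarrow> (\<exists>y\<in>block M x. y \<in> e)" for e
    using block_eq_iff[OF assms(1), of _ x] by (metis (no_types, lifting) image_iff)
  then have "{e \<in> edges G. block M x \<in> block M ` e} = (\<Union>y\<in>block M x. ?I y)"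
    by blast
  moreover have "{e \<in> edges (merge M G). block M x \<in> e} =
      (`) (block M) ` {e \<in> edges G. block M x \<in> block M ` e}"
    unfolding merge_def by auto
  ultimately have "{e \<in> edges (merge M G). block M x \<in> e} = (`) (block M) ` (\<Union>y\<in>block M x. ?I y)"
    by simp
  moreover have "inj_on ((`) (block M)) (\<Union>y\<in>block M x. ?I y)"
    by (rule inj_on_subset[OF inj]) blast
  ultimately have "vsum (merge M G) f (block M x) = (\<Sum>e\<in>(\<Union>y\<in>block M x. ?I y). f (block M ` e))"
    unfolding vsum_def by (simp add: sum.reindex)
  also have "\<dots> = (\<Sum>y\<in>block M x. vsum G (\<lambda>e. f (block M ` e)) y)"
    unfolding vsum_def
  proof (rule sum.UNION_disjoint)
    show "\<forall>y\<in>block M x. \<forall>z\<in>block M x. y \<noteq> z \<longrightarrow> ?I y \<inter> ?I z = {}"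
    proof (intro ballI impI)
      fix y z assume "y \<in> block M x" "z \<in> block M x" "y \<noteq> z"
      then have "block M y = block M z" using block_eq_iff[OF assms(1), of y x] block_eq_iff[OF assms(1), of z x] by simp
      then show "?I y \<inter> ?I z = {}"
        using no_loops \<open>y \<noteq> z\<close> by (auto dest: inj_onD)
    qed
  qed (use assms in auto)
  finally show ?thesis .
qed

section \<open>Edges and vertex sums within one copy\<close>

lemma E0_subset: "e \<in> E0 i \<Longrightarrow> e \<subseteq> V0 i"
  unfolding E0_def V0_def by (elim insertE emptyE) simp_all

lemma card_E0: "e \<in> E0 i \<Longrightarrow> card e = 2"
  unfolding E0_def by (elim insertE emptyE) simp_all

lemma V0_disjoint: "x \<in> V0 i \<Longrightarrow> x \<in> V0 j \<Longrightarrow> i = j"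
  unfolding V0_def by auto

lemma E0_disjoint:
  assumes "e \<in> E0 i" "e \<in> E0 j"
  shows "i = j"
proof -
  have "e \<noteq> {}" using card_E0[OF assms(1)] by auto
  then show ?thesis using E0_subset V0_disjoint assms by blast
qed

text \<open>The order matters: the edge at position \<open>k\<close> receives entry \<open>k\<close>
  of \<open>label_list\<close>.\<close>

definition edge_list :: "nat \<Rightarrow> vertex set list" where
  "edge_list i =
    [{U i 1, U i 2}, {U i 2, U i 3}, {U i 3, U i 4}, {U i 4, U i 5},
     {U i 5, U i 6}, {U i 6, U i 7}, {U i 7, U i 8}, {U i 8, U i 1},
     {V i 1, V i 2}, {V i 2, V i 3}, {V i 3, V i 4}, {V i 4, V i 5},
     {V i 5, V i 6}, {V i 6, V i 7}, {V i 7, V i 8}, {V i 8, V i 1},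
     {U i 2, V i 2}, {U i 4, V i 4}, {U i 6, V i 6}, {U i 8, V i 8}]"

lemma set_edge_list: "set (edge_list i) = E0 i"
  unfolding edge_list_def E0_def by (simp only: list.set)

lemma distinct_edge_list: "distinct (edge_list i)"
  unfolding edge_list_def by (simp add: doubleton_eq_iff)

lemma length_edge_list: "length (edge_list i) = 20"
  unfolding edge_list_def by simp

lemma vsum_copies_V0:
  assumes "i \<in> {1..n}" "x \<in> V0 i"
  shows "vsum (copies n) g x = (\<Sum>e\<leftarrow>edge_list i. if x \<in> e then g e else 0)"
proof -
  have "{e \<in> edges (copies n). x \<in> e} = {e\<in>E0 i. x \<in> e}"
    unfolding edges_copies using E0_subset V0_disjoint assms by blast
  then have "vsum (copies n) g x = (\<Sum>e\<in>set (edge_list i). if x \<in> e then g e else 0)"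
    unfolding vsum_def set_edge_list[symmetric] by (simp add: sum.inter_filter)
  then show ?thesis
    by (simp add: sum_list_distinct_conv_sum_set distinct_edge_list)
qed

lemma vsum_copies:
  assumes "i \<in> {1..n}"
  shows "vsum (copies n) g (U i 1) = g {U i 1, U i 2} + g {U i 8, U i 1}"
    "vsum (copies n) g (U i 2) = g {U i 1, U i 2} + g {U i 2, U i 3} + g {U i 2, V i 2}"
    "vsum (copies n) g (U i 3) = g {U i 2, U i 3} + g {U i 3, U i 4}"
    "vsum (copies n) g (U i 4) = g {U i 3, U i 4} + g {U i 4, U i 5} + g {U i 4, V i 4}"
    "vsum (copies n) g (U i 5) = g {U i 4, U i 5} + g {U i 5, U i 6}"
    "vsum (copies n) g (U i 6) = g {U i 5, U i 6} + g {U i 6, U i 7} + g {U i 6, V i 6}"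
    "vsum (copies n) g (U i 7) = g {U i 6, U i 7} + g {U i 7, U i 8}"
    "vsum (copies n) g (U i 8) = g {U i 7, U i 8} + g {U i 8, U i 1} + g {U i 8, V i 8}"
    "vsum (copies n) g (V i 1) = g {V i 1, V i 2} + g {V i 8, V i 1}"
    "vsum (copies n) g (V i 2) = g {V i 1, V i 2} + g {V i 2, V i 3} + g {U i 2, V i 2}"
    "vsum (copies n) g (V i 3) = g {V i 2, V i 3} + g {V i 3, V i 4}"
    "vsum (copies n) g (V i 4) = g {V i 3, V i 4} + g {V i 4, V i 5} + g {U i 4, V i 4}"
    "vsum (copies n) g (V i 5) = g {V i 4, V i 5} + g {V i 5, V i 6}"
    "vsum (copies n) g (V i 6) = g {V i 5, V i 6} + g {V i 6, V i 7} + g {U i 6, V i 6}"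
    "vsum (copies n) g (V i 7) = g {V i 6, V i 7} + g {V i 7, V i 8}"
    "vsum (copies n) g (V i 8) = g {V i 7, V i 8} + g {V i 8, V i 1} + g {U i 8, V i 8}"
  by (subst vsum_copies_V0[OF assms], simp add: V0_def, simp add: edge_list_def)+

lemma pairwise_disjnt_UN:
  assumes "\<And>i. pairwise disjnt (F i)"
    and "\<And>i j B C. B \<in> F i \<Longrightarrow> C \<in> F j \<Longrightarrow> i \<noteq> j \<Longrightarrow> disjnt B C"
  shows "pairwise disjnt (\<Union>i\<in>I. F i)"
proof (rule pairwiseI)
  fix B C assume "B \<in> (\<Union>i\<in>I. F i)" "C \<in> (\<Union>i\<in>I. F i)" "B \<noteq> C"
  then obtain i j where "B \<in> F i" "C \<in> F j" by blast
  then show "disjnt B C"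
    using assms(1)[of i] assms(2)[of B i C j] \<open>B \<noteq> C\<close> by (cases "i = j") (auto dest: pairwiseD)
qed

lemma pairwise_disjnt_M:
  assumes "M \<in> {M1 n, M2 n, M3 n}"
  shows "pairwise disjnt M"
proof -
  have "pairwise disjnt (M1 n)" unfolding M1_def
  proof (rule pairwise_disjnt_UN)
    show "pairwise disjnt {{U i 1, U i 5}, {U i 3, U i 7}, {V i 1, V i 5}, {V i 3, V i 7}}" for i
      by (rule pairwiseI) (elim insertE emptyE; simp add: disjnt_def)
  qed (elim insertE emptyE; simp add: disjnt_def)
  moreover have "pairwise disjnt (M2 n)" unfolding M2_def
  proof (rule pairwise_disjnt_UN)
    show "pairwise disjnt {{U i 1, V i 7}, {U i 5, V i 3}, {U i 3, V i 5}, {U i 7, V i 1}}" for i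
      by (rule pairwiseI) (elim insertE emptyE; simp add: disjnt_def)
  qed (elim insertE emptyE; simp add: disjnt_def)
  moreover have "pairwise disjnt (M3 n)" unfolding M3_def
  proof (rule pairwise_disjnt_UN)
    show "pairwise disjnt {{U i 1, V i 1}, {U i 5, V i 5}, {U i 3, V i 3}, {U i 7, V i 7}}" for i
      by (rule pairwiseI) (elim insertE emptyE; simp add: disjnt_def)
  qed (elim insertE emptyE; simp add: disjnt_def)
  ultimately show ?thesis using assms by auto
qed

lemma vsum_merge_copies:
  assumes "M \<in> {M1 n, M2 n, M3 n}" "i \<in> {1..n}" "x \<in> V0 i"
  shows "vsum (merge M (copies n)) f (block M x) =
    (\<Sum>y\<in>block M x. vsum (copies n) (\<lambda>e. f (block M ` e)) y)"
proof (rule vsum_merge)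
  show "pairwise disjnt M" using pairwise_disjnt_M assms(1) .
  have "finite (E0 j)" for j unfolding E0_def by simp
  then show "finite (edges (copies n))" unfolding edges_copies by simp
  show "finite (block M x)"
    using assms(1,3) unfolding V0_def
    by (elim insertE emptyE)
       (simp_all add: block_M1[OF assms(2), simplified] block_M2[OF assms(2), simplified]
          block_M3[OF assms(2), simplified])
  show "inj_on ((`) (block M)) (edges (copies n))" using inj_on_edges assms(1) .
  fix e assume e: "e \<in> edges (copies n)"
  then have "card e = 2" unfolding edges_copies using card_E0 by blast
  \<comment> \<open>The image keeps two elements, so \<open>block M\<close> does not identify the
    ends of \<open>e\<close>: merging creates no loop.\<close>
  moreover have "card (block M ` e) = 2"
    using simple_graph_merge(1)[OF assms(1)] e unfolding simple_graph_def merge_def by auto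
  ultimately show "inj_on (block M) e"
    by (intro eq_card_imp_inj_on) (auto intro: card_ge_0_finite)
qed

section \<open>The labelling\<close>

text \<open>
  At each position, the labels for \<open>i = 1, \<dots>, n\<close> fill an interval of length \<open>n\<close> or one parity
  class of an interval of length \<open>2n\<close>; no subtraction truncates for these \<open>i\<close>.
\<close>
definition label_list :: "nat \<Rightarrow> nat \<Rightarrow> nat list" where
  "label_list n i =
    [10*n+1-2*i, 13*n+i, 11*n+1-i, 16*n+2*i, 8*n+1-2*i, 12*n+i, 12*n+1-i, 14*n+2*i,
     10*n+2-2*i, 19*n+i, 5*n+1-i, 16*n+2*i-1, 8*n+2-2*i, 18*n+i, 6*n+1-i, 14*n+2*i-1,
     i, 2*n+1-i, 3*n+i, 3*n+1-i]"

text \<open>Edges and labels are indexed by the same pairs of copy and position;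
  \<open>ex_edge_labelling\<close> composes the inverse of this bijection with that of
  \<open>bij_betw_labels\<close>.\<close>

lemma bij_betw_edges:
  "bij_betw (\<lambda>(i, k). edge_list i ! k) ({1..n} \<times> {..<20}) (edges (copies n))"
proof (rule bij_betw_imageI)
  show "inj_on (\<lambda>(i, k). edge_list i ! k) ({1..n} \<times> {..<20})"
  proof (rule inj_onI, clarify)
    fix i k j l assume "k < (20::nat)" "l < (20::nat)" and eq: "edge_list i ! k = edge_list j ! l"
    then have "edge_list i ! k \<in> E0 i" "edge_list i ! k \<in> E0 j"
      using length_edge_list set_edge_list nth_mem by metis+
    then have "i = j" by (rule E0_disjoint)
    then show "i = j \<and> k = l"
      using eq \<open>k < 20\<close> \<open>l < 20\<close> by (simp add: nth_eq_iff_index_eq distinct_edge_list length_edge_list)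
  qed
  have "(\<lambda>k. edge_list i ! k) ` {..<20} = E0 i" for i
    using set_edge_list[of i] length_edge_list[of i] by (auto simp: set_conv_nth)
  moreover have "(\<lambda>(i, k). edge_list i ! k) ` ({1..n} \<times> {..<20}) =
      (\<Union>i\<in>{1..n}. (\<lambda>k. edge_list i ! k) ` {..<20})"
    by auto
  ultimately show "(\<lambda>(i, k). edge_list i ! k) ` ({1..n} \<times> {..<20}) = edges (copies n)"
    unfolding edges_copies by simp
qed

text \<open>The interval is filled from below, piece by piece. In \<open>up\<close> and
  \<open>down\<close> one position fills a piece of length \<open>n\<close>, rising or falling with
  \<open>i\<close>; in \<open>up2\<close> and \<open>down2\<close> an edge of the u-cycle and the
  matching edge of the v-cycle supply the two parity classes of a piece of length
  \<open>2*n\<close>.\<close>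

lemma labels_cover: "{0<..20*n} \<subseteq> (\<Union>i\<in>{1..n}. set (label_list n i))"
proof -
  let ?L = "\<Union>i\<in>{1..n}. set (label_list n i)"
  have join: "{0<..b} \<subseteq> L" if "{0<..a} \<subseteq> L" "\<And>v. v \<in> {a<..b} \<Longrightarrow> v \<in> L" for a b :: nat and L
  proof
    show "v \<in> L" if "v \<in> {0<..b}" for v
      using that \<open>{0<..a} \<subseteq> L\<close> \<open>\<And>v. v \<in> {a<..b} \<Longrightarrow> v \<in> L\<close> by (cases "v \<le> a") auto
  qed
  have up: "{0<..b} \<subseteq> ?L"
    if "{0<..a} \<subseteq> ?L" "b = a + n" "\<forall>i\<in>{1..n}. a + i \<in> set (label_list n i)" for a b
  proof (rule join[OF that(1)])
    fix v assume "v \<in> {a<..b}"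
    then have "v - a \<in> {1..n}" "v = a + (v - a)" using that(2) by auto
    then show "v \<in> ?L" using that(3) by (metis UN_I)
  qed
  have down: "{0<..b} \<subseteq> ?L"
    if "{0<..a} \<subseteq> ?L" "b = a + n" "\<forall>i\<in>{1..n}. b + 1 - i \<in> set (label_list n i)" for a b
  proof (rule join[OF that(1)])
    fix v assume "v \<in> {a<..b}"
    then have "b + 1 - v \<in> {1..n}" "v = b + 1 - (b + 1 - v)" using that(2) by auto
    then show "v \<in> ?L" using that(3) by (metis UN_I)
  qed
  have up2: "{0<..b} \<subseteq> ?L"
    if "{0<..a} \<subseteq> ?L" "b = a + 2*n"
      "\<forall>i\<in>{1..n}. a + 2*i \<in> set (label_list n i) \<and> a + 2*i - 1 \<in> set (label_list n i)" for a b
  proof (rule join[OF that(1)])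
    fix v assume v: "v \<in> {a<..b}"
    \<comment> \<open>Half of \<open>v - a\<close>, rounded up, since the offsets
      \<open>2*i - 1\<close> and \<open>2*i\<close> belong to the same \<open>i\<close>.\<close>
    define i where "i = (v - a + 1) div 2"
    have "v = a + 2*i \<or> v = a + 2*i - 1" "i \<in> {1..n}"
      using v that(2) unfolding i_def greaterThanAtMost_iff atLeastAtMost_iff by presburger+
    then show "v \<in> ?L" using that(3) by (metis UN_I)
  qed
  have down2: "{0<..b} \<subseteq> ?L"
    if "{0<..a} \<subseteq> ?L" "b = a + 2*n"
      "\<forall>i\<in>{1..n}. b + 1 - 2*i \<in> set (label_list n i) \<and> b + 2 - 2*i \<in> set (label_list n i)" for a b
  proof (rule join[OF that(1)])
    fix v assume v: "v \<in> {a<..b}"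
    \<comment> \<open>Counted from the top, the distances \<open>2*q\<close> and
      \<open>2*q + 1\<close> both belong to copy \<open>q + 1\<close>.\<close>
    define r where "r = b - v"
    have "r = 2*(r div 2) \<or> r = 2*(r div 2) + 1" by presburger
    moreover have "v + r = b" "r < 2*n" using v that(2) unfolding r_def by auto
    ultimately have "v = b + 1 - 2*(r div 2 + 1) \<or> v = b + 2 - 2*(r div 2 + 1)"
      and "r div 2 + 1 \<in> {1..n}"
      by auto
    then show "v \<in> ?L" using that(3) by (metis UN_I)
  qed
  have "{0<..0} \<subseteq> ?L" by simp
  then have "{0<..n} \<subseteq> ?L" by (rule up) (simp_all add: label_list_def)
  then have "{0<..2*n} \<subseteq> ?L" by (rule down) (simp_all add: label_list_def)
  then have "{0<..3*n} \<subseteq> ?L" by (rule down) (simp_all add: label_list_def)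
  then have "{0<..4*n} \<subseteq> ?L" by (rule up) (simp_all add: label_list_def)
  then have "{0<..5*n} \<subseteq> ?L" by (rule down) (simp_all add: label_list_def)
  then have "{0<..6*n} \<subseteq> ?L" by (rule down) (simp_all add: label_list_def)
  then have "{0<..8*n} \<subseteq> ?L" by (rule down2) (simp_all add: label_list_def)
  then have "{0<..10*n} \<subseteq> ?L" by (rule down2) (simp_all add: label_list_def)
  then have "{0<..11*n} \<subseteq> ?L" by (rule down) (simp_all add: label_list_def)
  then have "{0<..12*n} \<subseteq> ?L" by (rule down) (simp_all add: label_list_def)
  then have "{0<..13*n} \<subseteq> ?L" by (rule up) (simp_all add: label_list_def)
  then have "{0<..14*n} \<subseteq> ?L" by (rule up) (simp_all add: label_list_def)
  then have "{0<..16*n} \<subseteq> ?L" by (rule up2) (simp_all add: label_list_def)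
  then have "{0<..18*n} \<subseteq> ?L" by (rule up2) (simp_all add: label_list_def)
  then have "{0<..19*n} \<subseteq> ?L" by (rule up) (simp_all add: label_list_def)
  then show ?thesis by (rule up) (simp_all add: label_list_def)
qed

lemma length_label_list: "length (label_list n i) = 20"
  unfolding label_list_def by simp

text \<open>Coverage suffices by counting: \<open>20*n\<close> indices whose values include all
  \<open>20*n\<close> labels can neither repeat a value nor produce another one.\<close>

lemma bij_betw_labels:
  "bij_betw (\<lambda>(i, k). label_list n i ! k) ({1..n} \<times> {..<20}) {1..20*n}"
proof -
  let ?K = "{1..n} \<times> {..<20::nat}" and ?h = "\<lambda>(i, k). label_list n i ! k"
  have card: "card ?K = 20*n" by simp
  have sub: "{1..20*n} \<subseteq> ?h ` ?K"
  proof
    fix v assume "v \<in> {1..20*n}"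
    then have "v \<in> {0<..20*n}" by simp
    then obtain i where "i \<in> {1..n}" "v \<in> set (label_list n i)" using labels_cover by blast
    moreover then obtain k where "k < 20" "v = label_list n i ! k"
      by (metis in_set_conv_nth length_label_list)
    ultimately show "v \<in> ?h ` ?K" by force
  qed
  have "card (?h ` ?K) \<le> 20*n" using card_image_le[of ?K ?h] card by simp
  then have "?h ` ?K = {1..20*n}" using card_seteq[OF _ sub] by simp
  moreover from this have "inj_on ?h ?K" by (intro eq_card_imp_inj_on) simp_all
  ultimately show ?thesis by (simp add: bij_betw_def)
qed

lemma ex_edge_labelling:
  obtains g where "bij_betw g (edges (copies n)) {1..20*n}"
    and "\<And>i. i \<in> {1..n} \<Longrightarrow> map g (edge_list i) = label_list n i"
proof
  let ?K = "{1..n} \<times> {..<20::nat}"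
  let ?e = "\<lambda>(i, k). edge_list i ! k" and ?l = "\<lambda>(i, k). label_list n i ! k"
  show "bij_betw (?l \<circ> inv_into ?K ?e) (edges (copies n)) {1..20*n}"
    using bij_betw_trans[OF bij_betw_inv_into[OF bij_betw_edges] bij_betw_labels] .
  fix i assume "i \<in> {1..n}"
  then have "(?l \<circ> inv_into ?K ?e) (?e (i, k)) = label_list n i ! k" if "k < 20" for k
    using that inv_into_f_f[OF bij_betw_imp_inj_on[OF bij_betw_edges], of "(i, k)" n] by simp
  then show "map (?l \<circ> inv_into ?K ?e) (edge_list i) = label_list n i"
    by (intro nth_equalityI) (simp_all add: length_edge_list length_label_list)
qed

lemma edge_labels:
  assumes "map g (edge_list i) = label_list n i"
  shows "g {U i 1, U i 2} = 10*n+1-2*i" "g {U i 2, U i 3} = 13*n+i"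
    "g {U i 3, U i 4} = 11*n+1-i" "g {U i 4, U i 5} = 16*n+2*i"
    "g {U i 5, U i 6} = 8*n+1-2*i" "g {U i 6, U i 7} = 12*n+i"
    "g {U i 7, U i 8} = 12*n+1-i" "g {U i 8, U i 1} = 14*n+2*i"
    "g {V i 1, V i 2} = 10*n+2-2*i" "g {V i 2, V i 3} = 19*n+i"
    "g {V i 3, V i 4} = 5*n+1-i" "g {V i 4, V i 5} = 16*n+2*i-1"
    "g {V i 5, V i 6} = 8*n+2-2*i" "g {V i 6, V i 7} = 18*n+i"
    "g {V i 7, V i 8} = 6*n+1-i" "g {V i 8, V i 1} = 14*n+2*i-1"
    "g {U i 2, V i 2} = i" "g {U i 4, V i 4} = 2*n+1-i"
    "g {U i 6, V i 6} = 3*n+i" "g {U i 8, V i 8} = 3*n+1-i"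
  using assms unfolding edge_list_def label_list_def list.map by (simp_all only: list.inject)

text \<open>The edges \<open>{U i (2*j), V i (2*j)}\<close> take the labels up to
  \<open>4*n\<close>. The cycle edges take the rest, an interval symmetric under the reflection of
  \<open>x\<close> to \<open>24*n + 1 - x\<close>, and the two edges at each odd vertex carry labels
  exchanged by it. At each even vertex the multiples of \<open>i\<close> cancel, as -2+1+1 or
  2-1-1.\<close>

lemma vsum_labelling:
  assumes "i \<in> {1..n}" "map g (edge_list i) = label_list n i"
  shows "vsum (copies n) g (U i 1) = 24*n+1" "vsum (copies n) g (U i 2) = 23*n+1"
    "vsum (copies n) g (U i 3) = 24*n+1" "vsum (copies n) g (U i 4) = 29*n+2"
    "vsum (copies n) g (U i 5) = 24*n+1" "vsum (copies n) g (U i 6) = 23*n+1"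
    "vsum (copies n) g (U i 7) = 24*n+1" "vsum (copies n) g (U i 8) = 29*n+2"
    "vsum (copies n) g (V i 1) = 24*n+1" "vsum (copies n) g (V i 2) = 29*n+2"
    "vsum (copies n) g (V i 3) = 24*n+1" "vsum (copies n) g (V i 4) = 23*n+1"
    "vsum (copies n) g (V i 5) = 24*n+1" "vsum (copies n) g (V i 6) = 29*n+2"
    "vsum (copies n) g (V i 7) = 24*n+1" "vsum (copies n) g (V i 8) = 23*n+1"
  unfolding vsum_copies[OF assms(1)] edge_labels[OF assms(2)] using assms(1) by auto

section \<open>Transfer of the labelling to the merged graphs\<close>

fun color :: "nat \<Rightarrow> vertex \<Rightarrow> nat" where
  "color n (U i t) = (if odd t then 48*n+2 else if t mod 4 = 2 then 23*n+1 else 29*n+2)"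
| "color n (V i t) = (if odd t then 48*n+2 else if t mod 4 = 2 then 29*n+2 else 23*n+1)"

text \<open>Cycle edges join an odd index to an even one; the other edges join equal even indices,
  where \<open>U\<close> and \<open>V\<close> have exchanged values. \<open>n \<ge> 1\<close>
  separates \<open>29*n+2\<close> from \<open>48*n+2\<close>.\<close>

lemma color_edge: "n \<ge> 1 \<Longrightarrow> {x, y} \<in> E0 i \<Longrightarrow> color n x \<noteq> color n y"
  unfolding E0_def insert_iff empty_iff doubleton_eq_iff
  by (elim disjE conjE FalseE; simp)

text \<open>This moves the condition to the original vertices, where adjacency is given by the
  explicit sets \<open>E0 i\<close>; \<open>inj_on_edges\<close> keeps the number of edges at
  \<open>20*n\<close>.\<close>

lemma local_antimagic_merge_iff:
  assumes "M \<in> {M1 n, M2 n, M3 n}"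
  shows "local_antimagic (merge M (copies n)) f \<longleftrightarrow>
    bij_betw f (edges (merge M (copies n))) {1..20*n} \<and>
    (\<forall>i\<in>{1..n}. \<forall>x y. {x, y} \<in> E0 i \<longrightarrow>
      vsum (merge M (copies n)) f (block M x) \<noteq> vsum (merge M (copies n)) f (block M y))"
    (is "_ \<longleftrightarrow> _ \<and> ?r")
proof -
  let ?G = "merge M (copies n)" and ?w = "vsum (merge M (copies n)) f"
  have E: "edges ?G = (`) (block M) ` (\<Union>i\<in>{1..n}. E0 i)"
    unfolding merge_def edges_copies by simp
  have "card (edges (copies n)) = 20*n"
    using bij_betw_same_card[OF bij_betw_edges[of n]] by simp
  then have card: "card (edges ?G) = 20*n"
    using card_image[OF inj_on_edges[OF assms]] unfolding merge_def by simp
  have "(\<forall>u v. {u, v} \<in> edges ?G \<longrightarrow> ?w u \<noteq> ?w v) \<longleftrightarrow> ?r"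
  proof
    assume *: "\<forall>u v. {u, v} \<in> edges ?G \<longrightarrow> ?w u \<noteq> ?w v"
    show ?r
    proof (intro ballI allI impI)
      fix i x y assume "i \<in> {1..n}" "{x, y} \<in> E0 i"
      then have "block M ` {x, y} \<in> edges ?G" unfolding E by blast
      then show "?w (block M x) \<noteq> ?w (block M y)" using * by simp
    qed
  next
    assume r: ?r
    show "\<forall>u v. {u, v} \<in> edges ?G \<longrightarrow> ?w u \<noteq> ?w v"
    proof (intro allI impI)
      fix u v assume "{u, v} \<in> edges ?G"
      then obtain i e where ie: "i \<in> {1..n}" "e \<in> E0 i" "{u, v} = block M ` e" unfolding E by blast
      then obtain x y where e: "e = {x, y}" using card_E0 card_2_iff by metis
      \<comment> \<open>Equality of unordered pairs does not tell which of \<open>x\<close>,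
        \<open>y\<close> gives \<open>u\<close>, so both orders must be available.\<close>
      then have "{y, x} \<in> E0 i" using ie(2) by (simp add: insert_commute)
      then show "?w u \<noteq> ?w v"
        using r ie e by (auto simp: doubleton_eq_iff)
    qed
  qed
  then show ?thesis unfolding local_antimagic_def card by simp
qed

lemma chi_la_attained:
  assumes "M \<in> {M1 n, M2 n, M3 n}" "n \<ge> 1"
  obtains f where "local_antimagic (merge M (copies n)) f"
    and "card (vsum (merge M (copies n)) f ` verts (merge M (copies n))) = 3"
proof -
  let ?G = "merge M (copies n)" and ?E = "edges (copies n)"
  obtain g where g: "bij_betw g ?E {1..20*n}"
    and labels: "\<And>i. i \<in> {1..n} \<Longrightarrow> map g (edge_list i) = label_list n i"
    using ex_edge_labelling by blast
  \<comment> \<open>A merged edge inherits the label of its unique preimage.\<close>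
  define f where "f = g \<circ> inv_into ?E ((`) (block M))"
  have bij: "bij_betw ((`) (block M)) ?E (edges ?G)"
    unfolding merge_def snd_conv by (rule bij_betw_imageI[OF inj_on_edges[OF assms(1)] refl])
  have f_bij: "bij_betw f (edges ?G) {1..20*n}"
    unfolding f_def by (rule bij_betw_trans[OF bij_betw_inv_into[OF bij] g])
  have "f (block M ` e) = g e" if "e \<in> ?E" for e
    unfolding f_def using inv_into_f_f[OF bij_betw_imp_inj_on[OF bij] that] by simp
  then have "vsum (copies n) (\<lambda>e. f (block M ` e)) y = vsum (copies n) g y" for y
    unfolding vsum_def by (intro sum.cong) auto
  then have vsum: "vsum ?G f (block M x) = (\<Sum>y\<in>block M x. vsum (copies n) g y)"
    if "i \<in> {1..n}" "x \<in> V0 i" for i x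
    using vsum_merge_copies[OF assms(1) that] by simp
  \<comment> \<open>For each \<open>M\<close> a merged block consists of two odd vertices, of sum
    \<open>24*n+1\<close> each, while even vertices form singleton blocks and keep their
    sums.\<close>
  have colors: "vsum ?G f (block M x) = color n x" if "i \<in> {1..n}" "x \<in> V0 i" for i x
    using assms(1) that(2) unfolding vsum[OF that] V0_def
    by (elim insertE emptyE)
       (simp_all add: block_M1[OF that(1), simplified] block_M2[OF that(1), simplified]
          block_M3[OF that(1), simplified] vsum_labelling[OF that(1) labels[OF that(1)], simplified])
  have "vsum ?G f (block M x) \<noteq> vsum ?G f (block M y)" if "i \<in> {1..n}" "{x, y} \<in> E0 i" for i x y
    using color_edge[OF assms(2) that(2)] colors[OF that(1)] E0_subset[OF that(2)] by simp
  then have "local_antimagic ?G f"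
    unfolding local_antimagic_merge_iff[OF assms(1)] using f_bij by blast
  moreover have "vsum ?G f ` verts ?G = {23*n+1, 29*n+2, 48*n+2}"
  proof -
    \<comment> \<open>Every copy shows the same three values, so the union over the copies adds
      none.\<close>
    have "color n ` V0 i = {23*n+1, 29*n+2, 48*n+2}" for i
      unfolding V0_def by auto
    moreover have "verts ?G = (\<Union>i\<in>{1..n}. block M ` V0 i)"
      unfolding merge_def fst_conv verts_copies by (rule image_UN)
    then have "vsum ?G f ` verts ?G = (\<Union>i\<in>{1..n}. color n ` V0 i)"
      by (simp only: image_UN image_image) (intro SUP_cong image_cong refl colors)
    ultimately show ?thesis using assms(2) by auto
  qed
  ultimately show ?thesis using that assms(2) by simp
qed

section \<open>Two sums are not enough\<close>

lemma card_ge_3: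
  assumes "finite S" "{a, b, c} \<subseteq> S" "a \<noteq> b" "b \<noteq> c" "a \<noteq> c"
  shows "3 \<le> card S"
  using card_mono[OF assms(1,2)] assms(3-5) by simp

lemma local_antimagic_card_ge_3:
  assumes M: "M \<in> {M1 n, M2 n, M3 n}" and "n \<ge> 1"
    and f: "local_antimagic (merge M (copies n)) f"
  shows "3 \<le> card (vsum (merge M (copies n)) f ` verts (merge M (copies n)))"
proof (rule ccontr)
  let ?G = "merge M (copies n)"
  define w where "w x = vsum ?G f (block M x)" for x
  define S where "S = vsum ?G f ` verts ?G"
  assume "\<not> 3 \<le> card (vsum ?G f ` verts ?G)"
  then have card: "\<not> 3 \<le> card S" unfolding S_def .
  \<comment> \<open>The component of the first copy alone yields the contradiction.\<close>
  have one: "1 \<in> {1..n}" using assms(2) by simp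
  have fin: "finite S"
    unfolding S_def using simple_graph_merge(1)[OF M] unfolding simple_graph_def by simp
  have mem: "w x \<in> S" if "x \<in> V0 1" for x
    using that one unfolding S_def w_def merge_def fst_conv verts_copies by blast
  have adj: "w x \<noteq> w y" if "{x, y} \<in> E0 1" for x y
    using f that one unfolding local_antimagic_merge_iff[OF M] w_def by blast
  \<comment> \<open>With at most two values available, both neighbours of \<open>y\<close> take the
    one different from \<open>w y\<close>.\<close>
  have path: "w x = w z" if "{x, y} \<in> E0 1" "{y, z} \<in> E0 1" for x y z
    using card_ge_3[OF fin, of "w x" "w y" "w z"] adj[OF that(1)] adj[OF that(2)] card
      mem E0_subset[OF that(1)] E0_subset[OF that(2)] by auto
  from M consider "M = M1 n" | "M = M2 n" | "M = M3 n" by blast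
  then show False
  proof cases
    case 1
    define h where "h = vsum (copies n) (\<lambda>e. f (block M ` e))"
    have w: "w x = (\<Sum>y\<in>block M x. h y)" if "x \<in> V0 1" for x
      unfolding w_def h_def by (rule vsum_merge_copies[OF M one that])
    have "w (U 1 2) = h (U 1 2)" "w (U 1 4) = h (U 1 4)" "w (U 1 6) = h (U 1 6)"
      "w (U 1 8) = h (U 1 8)" "w (V 1 2) = h (V 1 2)" "w (V 1 4) = h (V 1 4)"
      "w (V 1 6) = h (V 1 6)" "w (V 1 8) = h (V 1 8)"
      "w (U 1 1) = h (U 1 1) + h (U 1 5)" "w (U 1 3) = h (U 1 3) + h (U 1 7)"
      "w (V 1 1) = h (V 1 1) + h (V 1 5)" "w (V 1 3) = h (V 1 3) + h (V 1 7)"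
      using block_M1[OF one] unfolding 1 by (subst w, simp add: V0_def, simp add: 1)+
    \<comment> \<open>Double counting: every edge has one end among the even \<open>U\<close> and
      odd \<open>V\<close> vertices and the other among the even \<open>V\<close> and odd
      \<open>U\<close> vertices, so both sides are the sum of all labels of the copy.\<close>
    moreover have "h (U 1 2) + h (U 1 4) + h (U 1 6) + h (U 1 8) +
        (h (V 1 1) + h (V 1 3) + h (V 1 5) + h (V 1 7)) =
      h (V 1 2) + h (V 1 4) + h (V 1 6) + h (V 1 8) +
        (h (U 1 1) + h (U 1 3) + h (U 1 5) + h (U 1 7))"
      unfolding h_def vsum_copies[OF one] by simp
    \<comment> \<open>Paths of length two make \<open>w\<close> constant on each part, which has
      four even vertices and two merged ones; the double count then reads
      \<open>6 * w (U 1 2) = 6 * w (U 1 1)\<close>.\<close>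
    moreover have "w (U 1 2) = w (U 1 4)" "w (U 1 4) = w (U 1 6)" "w (U 1 6) = w (U 1 8)"
      "w (V 1 2) = w (V 1 4)" "w (V 1 4) = w (V 1 6)" "w (V 1 6) = w (V 1 8)"
      "w (U 1 1) = w (U 1 3)" "w (V 1 1) = w (V 1 3)" "w (U 1 1) = w (V 1 2)" "w (V 1 1) = w (U 1 2)"
      by (rule path[of _ "U 1 3"] path[of _ "U 1 5"] path[of _ "U 1 7"]
          path[of _ "V 1 3"] path[of _ "V 1 5"] path[of _ "V 1 7"] path[of _ "U 1 2"] path[of _ "V 1 2"];
          simp add: E0_def doubleton_eq_iff; fail)+
    moreover have "w (U 1 1) \<noteq> w (U 1 2)" by (rule adj) (simp add: E0_def)
    ultimately show False by linarith
  next
    case 2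
    \<comment> \<open>The triangle consists of the merged vertex \<open>{U 1 3, V 1 5}\<close>,
      \<open>U 1 4\<close> and \<open>V 1 4\<close>.\<close>
    have "w (U 1 3) = w (V 1 5)" unfolding w_def 2 using block_M2[OF one] by simp
    moreover have "w (U 1 3) = w (V 1 4)" by (rule path[of _ "U 1 4"]) (simp_all add: E0_def insert_commute)
    moreover have "w (V 1 4) \<noteq> w (V 1 5)" by (rule adj) (simp add: E0_def)
    ultimately show False by simp
  next
    case 3
    \<comment> \<open>The triangle consists of the merged vertex \<open>{U 1 1, V 1 1}\<close>,
      \<open>U 1 2\<close> and \<open>V 1 2\<close>.\<close>
    have "w (U 1 1) = w (V 1 1)" unfolding w_def 3 using block_M3[OF one] by simp
    moreover have "w (U 1 1) = w (V 1 2)" by (rule path[of _ "U 1 2"]) (simp_all add: E0_def)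
    moreover have "w (V 1 1) \<noteq> w (V 1 2)" by (rule adj) (simp add: E0_def)
    ultimately show False by simp
  qed
qed

theorem theorem3p5:
  fixes n :: nat and G :: "vertex set ugraph"
  assumes "n \<ge> 1" and "G \<in> {H1 n, H2 n, H3 n}"
  shows "chi_la G = 3"
proof -
  obtain M where M: "M \<in> {M1 n, M2 n, M3 n}" and G: "G = merge M (copies n)"
    using assms(2) unfolding H1_def H2_def H3_def by blast
  obtain f where "local_antimagic G f" "card (vsum G f ` verts G) = 3"
    using chi_la_attained[OF M assms(1)] unfolding G by blast
  \<comment> \<open>The value 3 is attained and is a lower bound, so the infimum is a genuine
    minimum and not the default of an empty set.\<close>
  then show ?thesis
    unfolding chi_la_def
    by (intro cInf_eq_minimum) (use local_antimagic_card_ge_3[OF M assms(1)] in \<open>auto simp: G\<close>)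
qed

end
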